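(* Let $N\ge1$ and $d=2N$, and consider the symmetric random walk on the circle $\mathbb{Z}_d$ with parameter $p$, started at a fixed vertex. Let $T$ be a fastest strong stationary time for this walk. Then $$ET=\begin{cases}\dfrac{2N^2+1}{12p} & \text{if } N>1 \text{ and } p\in(0,1/3],\\[2mm] \dfrac{1}{4p} & \text{if } N=1\text{ and }p\in(0,1/4],\\[2mm] \dfrac{1}{2(1-2p)} & \text{if } N=1\text{ and }p\in(1/4,1/2).\end{cases}$$
   Context: The symmetric random walk on the circle $\mathbb{Z}_d=\{0,\ldots,d-1\}$ with parameter $p$ is the Markov chain which from state $i$ moves to $i+1 \bmod d$ with probability $p$, to $i-1\bmod d$ with probability $p$, and stays at $i$ with probability $1-2p$ (for $d=2$ the two moves lead to the same state, which is thus reached with probability $2p$). Its stationary distribution $\pi$ is uniform. For an ergodic Markov chain $(X_k)_{k\ge0}$ on a finite state space $\mathbb{E}$ with initial distribution $\nu$, transition matrix $P$ and stationary distribution $\pi$, the separation distance is $\mathrm{sep}(\nu P^k,\pi)=\max_{e\in\mathbb{E}}\big(1-\nu P^k(e)/\pi(e)\big)$. A strong stationary time is a randomized stopping time $T$ for the chain (a stopping time that may depend also on additional randomness independent of the future evolution of the chain given its past) such that $P(X_k=e\mid T=k)=\pi(e)$ for all $e\in\mathbb{E}$ and all $k$ with $P(T=k)>0$. A strong stationary time $T$ is a fastest strong stationary time if $\mathrm{sep}(\nu P^k,\pi)=P(T>k)$ for all $k\ge0$. *)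

theory Defs
  imports "HOL-Probability.Probability"
begin

text \<open>
  Finite Markov chains with state space \<open>E\<close>, initial distribution \<open>\<nu>\<close> and transition
  matrix \<open>P\<close> (\<open>P i j\<close> is the probability to move from \<open>i\<close> to \<open>j\<close>).
\<close>

definition path_event :: "'w measure \<Rightarrow> (nat \<Rightarrow> 'w \<Rightarrow> 's) \<Rightarrow> nat \<Rightarrow> (nat \<Rightarrow> 's) \<Rightarrow> 'w set" where
  "path_event M X k x = {\<omega> \<in> space M. \<forall>i\<le>k. X i \<omega> = x i}"

definition markov_chain ::
    "'w measure \<Rightarrow> 's set \<Rightarrow> ('s \<Rightarrow> real) \<Rightarrow> ('s \<Rightarrow> 's \<Rightarrow> real) \<Rightarrow> (nat \<Rightarrow> 'w \<Rightarrow> 's) \<Rightarrow> bool" where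
  "markov_chain M E \<nu> P X \<longleftrightarrow>
     prob_space M \<and> (\<forall>k. X k \<in> M \<rightarrow>\<^sub>M count_space E) \<and>
     (\<forall>k x. (\<forall>i\<le>k. x i \<in> E) \<longrightarrow>
        measure M (path_event M X k x) = \<nu> (x 0) * (\<Prod>i<k. P (x i) (x (Suc i))))"

primrec chain_dist :: "'s set \<Rightarrow> ('s \<Rightarrow> real) \<Rightarrow> ('s \<Rightarrow> 's \<Rightarrow> real) \<Rightarrow> nat \<Rightarrow> 's \<Rightarrow> real" where
  "chain_dist E \<nu> P 0 = \<nu>"
| "chain_dist E \<nu> P (Suc k) = (\<lambda>j. \<Sum>i\<in>E. chain_dist E \<nu> P k i * P i j)"

definition sep :: "'s set \<Rightarrow> ('s \<Rightarrow> real) \<Rightarrow> ('s \<Rightarrow> real) \<Rightarrow> real" where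
  "sep E \<mu> \<pi> = Max ((\<lambda>e. 1 - \<mu> e / \<pi> e) ` E)"

text \<open>
  The additional randomness is carried by a filtration \<open>F\<close> that may be larger than the one
  generated by \<open>X\<close>: the last conjunct says that, given the past \<open>X 0, \<dots>, X k\<close> of the chain,
  \<open>F k\<close> is independent of the future \<open>X (k + 1), \<dots>, X (k + m)\<close>. It is
  \<open>P(A, future | past) = P(A | past) P(future | past)\<close> multiplied out, which makes it trivially
  true for paths of probability 0. Times take values in \<^typ>\<open>enat\<close>, as \<open>T = \<infinity>\<close> is not excluded a
  priori; since \<^const>\<open>stopping_time\<close> uses one type for times and indices, \<open>F\<close> also has a (harmless)
  member \<open>F \<infinity>\<close>.
\<close>

definition randomized_stopping_time ::
    "'w measure \<Rightarrow> 's set \<Rightarrow> (nat \<Rightarrow> 'w \<Rightarrow> 's) \<Rightarrow> ('w \<Rightarrow> enat) \<Rightarrow> bool" where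
  "randomized_stopping_time M E X T \<longleftrightarrow>
     (\<exists>F :: enat \<Rightarrow> 'w measure.
        filtration (space M) F \<and> (\<forall>t. sets (F t) \<subseteq> sets M) \<and>
        (\<forall>k. X k \<in> F (enat k) \<rightarrow>\<^sub>M count_space E) \<and>
        stopping_time F T \<and>
        (\<forall>k m x. \<forall>A \<in> sets (F (enat k)).
           measure M (A \<inter> path_event M X (k + m) x) * measure M (path_event M X k x) =
           measure M (A \<inter> path_event M X k x) * measure M (path_event M X (k + m) x)))"

definition strong_stationary_time ::
    "'w measure \<Rightarrow> 's set \<Rightarrow> ('s \<Rightarrow> real) \<Rightarrow> (nat \<Rightarrow> 'w \<Rightarrow> 's) \<Rightarrow> ('w \<Rightarrow> enat) \<Rightarrow> bool" where
  "strong_stationary_time M E \<pi> X T \<longleftrightarrow>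
     randomized_stopping_time M E X T \<and>
     (\<forall>k. \<forall>e\<in>E. \<P>(\<omega> in M. T \<omega> = enat k) > 0 \<longrightarrow>
        \<P>(\<omega> in M. X k \<omega> = e \<bar> T \<omega> = enat k) = \<pi> e)"

definition fastest_strong_stationary_time ::
    "'w measure \<Rightarrow> 's set \<Rightarrow> ('s \<Rightarrow> real) \<Rightarrow> ('s \<Rightarrow> 's \<Rightarrow> real) \<Rightarrow> ('s \<Rightarrow> real) \<Rightarrow>
     (nat \<Rightarrow> 'w \<Rightarrow> 's) \<Rightarrow> ('w \<Rightarrow> enat) \<Rightarrow> bool" where
  "fastest_strong_stationary_time M E \<nu> P \<pi> X T \<longleftrightarrow>
     strong_stationary_time M E \<pi> X T \<and>
     (\<forall>k. sep E (chain_dist E \<nu> P k) \<pi> = \<P>(\<omega> in M. T \<omega> > enat k))"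

text \<open>
  States are \<open>0, \<dots>, d - 1\<close>. For \<open>d = 2\<close> the first two summands refer to the same state and
  add up to \<open>2 * p\<close>.
\<close>

definition circle_walk :: "nat \<Rightarrow> real \<Rightarrow> nat \<Rightarrow> nat \<Rightarrow> real" where
  "circle_walk d p i j =
     p * of_bool (j = (i + 1) mod d) + p * of_bool (j = (i + d - 1) mod d)
     + (1 - 2 * p) * of_bool (j = i)"

lemma circle_walk_row_sum:
  assumes "i < d"
  shows "(\<Sum>j<d. circle_walk d p i j) = 1"
proof -
  have *: "(\<Sum>j<d. c * of_bool (j = a)) = c" if "a < d" for a and c :: real
    using that by (simp add: of_bool_def if_distrib cong: if_cong)
  show ?thesis
    using assms by (simp add: circle_walk_def sum.distrib *)
qed

lemma circle_walk_uniform_stationary: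
  assumes "j < d"
  shows "(\<Sum>i<d. 1 / real d * circle_walk d p i j) = 1 / real d"
proof -
  have *: "(\<Sum>i<d. c * of_bool (i = a)) = c" if "a < d" for a and c :: real
    using that by (simp add: of_bool_def if_distrib cong: if_cong)
  have pred: "(b + d - 1) mod d = (if b = 0 then d - 1 else b - 1)" if "b < d" for b
  proof (cases b)
    case (Suc c)
    then have "(b + d - 1) mod d = (c + d) mod d"
      by simp
    then show ?thesis
      using Suc that by simp
  qed (use that in simp)
  have succ: "(b + 1) mod d = (if b = d - 1 then 0 else b + 1)" if "b < d" for b
  proof (cases "b = d - 1")
    case False
    then have "b + 1 < d"
      using that by linarith
    then show ?thesis
      using False by simp
  qed (use that in simp)
  have "circle_walk d p i j =
      p * of_bool (i = (j + d - 1) mod d) + p * of_bool (i = (j + 1) mod d)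
      + (1 - 2 * p) * of_bool (i = j)" if "i < d" for i
  proof -
    have "j = (i + 1) mod d \<longleftrightarrow> i = (j + d - 1) mod d"
      unfolding succ[OF that] pred[OF assms] using that assms by (simp, linarith)
    moreover have "j = (i + d - 1) mod d \<longleftrightarrow> i = (j + 1) mod d"
      unfolding succ[OF assms] pred[OF that] using that assms by (simp, linarith)
    ultimately show ?thesis
      by (simp only: circle_walk_def eq_commute[of j i])
  qed
  then have "(\<Sum>i<d. circle_walk d p i j) = 1"
    using assms by (simp add: sum.distrib *)
  then show ?thesis
    by (simp flip: sum_divide_distrib)
qed

end

theory Submission
  imports Defs
begin

text \<open>
  Since \<open>T\<close> is fastest, \<open>ET = \<Sum>k. P(T > k)\<close> is the sum of the separation distances.
  For the given ranges of \<open>p\<close> the law at each time decreases from the starting point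
  towards its antipode, where the separation is therefore attained, so it equals \<open>1 - d h\<^sub>k(0)\<close>
  with \<open>h\<^sub>k\<close> the law at time \<open>k\<close> in coordinates centred at the antipode. As
  \<open>j (d - j) / (2 p)\<close> has constant drift away from the antipode, its expectation under
  \<open>h\<^sub>k\<close> drops by exactly the separation in each step; the sum telescopes to the value at the start,
  \<open>N\<^sup>2 / (2 p)\<close>, minus the average \<open>(d\<^sup>2 - 1) / (12 p)\<close>. The remaining case \<open>N = 1\<close>, \<open>p > 1/4\<close> has
  two states and separation \<open>(4 p - 1)\<^sup>k\<close>.
\<close>

section \<open>The transition column and two finite sums\<close>

text \<open>Indexing states by integers mod \<open>d\<close> turns wrap-around into plain shifts of
  \<open>z\<close>, so the one-step recursion needs no case split at the ends.\<close>

lemma circle_walk_column: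
  assumes "d > 0" "i < d"
  shows "circle_walk d p i (nat (z mod int d)) =
    p * of_bool (i = nat ((z - 1) mod int d)) + p * of_bool (i = nat ((z + 1) mod int d))
    + (1 - 2 * p) * of_bool (i = nat (z mod int d))"
proof -
  have eq: "a mod int d = b mod int d \<longleftrightarrow> int d dvd a - b" for a b
    by (simp add: mod_eq_dvd_iff)
  have nat_eq: "int n = z \<Longrightarrow> n = nat z" for n z by simp
  have i: "i = nat (int i mod int d)"
    using assms by simp
  have [simp]: "nat (a mod int d) = nat (b mod int d) \<longleftrightarrow> a mod int d = b mod int d" for a b
    using assms by (simp add: eq_nat_nat_iff)
  have s: "(i + 1) mod d = nat ((int i + 1) mod int d)"
    by (rule nat_eq) (simp add: zmod_int add.commute)
  have t: "(i + d - 1) mod d = nat ((int i - 1) mod int d)"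
  proof (rule nat_eq)
    have "int ((i + d - 1) mod d) = (int i - 1 + int d) mod int d"
      using assms by (simp add: zmod_int of_nat_diff algebra_simps)
    then show "int ((i + d - 1) mod d) = (int i - 1) mod int d"
      by simp
  qed
  have 1: "nat (z mod int d) = (i + 1) mod d \<longleftrightarrow> i = nat ((z - 1) mod int d)"
    by (subst (2) i, unfold s) (simp add: eq, metis (no_types, opaque_lifting) dvd_minus_iff
      add.commute diff_diff_eq minus_diff_eq)
  have 2: "nat (z mod int d) = (i + d - 1) mod d \<longleftrightarrow> i = nat ((z + 1) mod int d)"
    by (subst (2) i, unfold t) (simp add: eq, metis (no_types, opaque_lifting) dvd_minus_iff
      add.commute diff_diff_eq2 minus_diff_eq)
  show ?thesis
    unfolding circle_walk_def 1 2 by (simp add: eq_commute)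
qed

text \<open>Moves the second difference from \<open>h\<close> to the parabola, whose own second
  difference is -2. Here \<open>c\<close> stays fixed while \<open>n\<close> grows in the induction;
  \<open>c = n = d\<close> is the case of interest.\<close>

lemma summation_by_parts_quadratic:
  fixes h :: "int \<Rightarrow> real" and c :: real
  shows "(\<Sum>j<n. real j * (c - real j) * (h (int j - 1) - 2 * h (int j) + h (int j + 1))) =
    (real n - 1) * (c - real n + 1) * h (int n) - real n * (c - real n) * h (int n - 1)
    + (c + 1) * h 0 - 2 * (\<Sum>j<n. h (int j))"
proof (induction n)
  case (Suc n)
  have "int (Suc n) = int n + 1" "int (Suc n) - 1 = int n" by simp_all
  then show ?case
    unfolding sum.lessThan_Suc Suc.IH by (simp add: algebra_simps)
qed (simp add: algebra_simps)

lemma sum_parabola: "(\<Sum>j<n. real j * (c - real j)) =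
  c * real n * (real n - 1) / 2 - real n * (real n - 1) * (2 * real n - 1) / 6"
  by (induction n) (simp_all add: field_simps)

section \<open>The law of the walk in centred coordinates\<close>

locale even_circle_walk =
  fixes N d x0 :: nat and p :: real
  assumes N: "N \<ge> 1" and d: "d = 2 * N" and x0: "x0 < d" and p: "0 < p" "p \<le> 1/2"
begin

abbreviation dist_at :: "nat \<Rightarrow> nat \<Rightarrow> real" where
  "dist_at \<equiv> chain_dist {..<d} (\<lambda>i. of_bool (i = x0)) (circle_walk d p)"

text \<open>Coordinates are centred at the antipode of the starting point.\<close>

definition h :: "nat \<Rightarrow> int \<Rightarrow> real" where
  "h k z = dist_at k (nat ((int x0 + int N + z) mod int d))"

lemma d_pos: "d > 0"
  using N d by simp

lemma h_0: "h 0 z = of_bool (int d dvd int N + z)"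
proof -
  have "nat ((int x0 + int N + z) mod int d) = x0 \<longleftrightarrow> (int x0 + int N + z) mod int d = int x0 mod int d"
    using d_pos x0 by (auto simp: nat_eq_iff)
  then show ?thesis
    by (simp add: h_def mod_eq_dvd_iff add.assoc)
qed

lemma h_init:
  assumes "j < d"
  shows "h 0 (int j) = of_bool (j = N)"
proof -
  have "int d dvd int N + int j \<longleftrightarrow> j = N"
  proof
    assume "int d dvd int N + int j"
    then obtain c where c: "int N + int j = int d * c" by auto
    have "0 < int N + int j" "int N + int j < int d * 2"
      using N d assms by linarith+
    then have "0 < c" "c < 2"
      using d_pos unfolding c by (simp_all add: zero_less_mult_iff)
    then have "c = 1" by simp
    with c show "j = N" by (simp add: d)
  qed (simp add: d)
  then show ?thesis
    by (simp add: h_0)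
qed

lemma h_Suc: "h (Suc k) z = (1 - 2 * p) * h k z + p * h k (z - 1) + p * h k (z + 1)"
proof -
  define y where "y = int x0 + int N + z"
  have lt: "nat (a mod int d) < d" for a
    using d_pos by (simp add: nat_less_iff)
  have *: "(\<Sum>i<d. f i * (c * of_bool (i = nat (a mod int d)))) = c * f (nat (a mod int d))"
    for f :: "nat \<Rightarrow> real" and c a
    using lt[of a] by (simp add: of_bool_def if_distrib mult.commute cong: if_cong)
  have "h (Suc k) z = (\<Sum>i<d. dist_at k i * circle_walk d p i (nat (y mod int d)))"
    by (simp add: h_def y_def)
  also have "\<dots> = (\<Sum>i<d. dist_at k i * (p * of_bool (i = nat ((y - 1) mod int d))
      + p * of_bool (i = nat ((y + 1) mod int d)) + (1 - 2 * p) * of_bool (i = nat (y mod int d))))"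
    by (intro sum.cong refl) (simp add: circle_walk_column d_pos)
  also have "\<dots> = p * dist_at k (nat ((y - 1) mod int d)) + p * dist_at k (nat ((y + 1) mod int d))
      + (1 - 2 * p) * dist_at k (nat (y mod int d))"
    by (simp only: distrib_left sum.distrib *)
  finally show ?thesis
    by (simp add: h_def y_def algebra_simps)
qed

lemma h_periodic: "h k (z + int d) = h k z"
proof -
  have "(int x0 + int N + (z + int d)) mod int d = (int x0 + int N + z) mod int d"
    by (metis add.assoc mod_add_self2)
  then show ?thesis
    by (simp add: h_def)
qed

text \<open>The start sits at \<open>N\<close>, congruent to \<open>- N\<close> mod
  \<open>d\<close>, and the recursion treats \<open>z - 1\<close> and \<open>z + 1\<close>
  alike.\<close>

lemma h_even: "h k (- z) = h k z"
proof (induction k arbitrary: z)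
  case 0
  have "int d dvd int N - z \<longleftrightarrow> int d dvd int d - (int N - z)"
    by (metis dvd_diff_right_iff dvd_refl)
  also have "int d - (int N - z) = int N + z"
    by (simp add: d)
  finally show ?case
    by (simp add: h_0)
next
  case (Suc k)
  show ?case
    using Suc[of z] Suc[of "z - 1"] Suc[of "z + 1"] by (simp add: h_Suc)
qed

lemma h_nonneg: "h k z \<ge> 0"
  by (induction k arbitrary: z) (use p in \<open>simp_all add: h_0 h_Suc\<close>)

lemma sum_h_shift: "(\<Sum>j<d. h k (int j + 1)) = (\<Sum>j<d. h k (int j))"
proof -
  have "(\<Sum>j<Suc d. h k (int j)) = h k 0 + (\<Sum>j<d. h k (int j + 1))"
    by (subst sum.lessThan_Suc_shift) (simp add: add.commute)
  then show ?thesis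
    using h_periodic[of k 0] by simp
qed

lemma sum_h: "(\<Sum>j<d. h k (int j)) = 1"
proof (induction k)
  case 0
  have "(\<Sum>j<d. h 0 (int j)) = (\<Sum>j<d. of_bool (j = N))"
    by (intro sum.cong) (auto simp: h_init)
  also have "\<dots> = 1"
    using N d by (simp add: of_bool_def)
  finally show ?case .
next
  case (Suc k)
  \<comment> \<open>Reflecting and then reversing the summation order turns the shift by -1 into a
    shift by 2, which periodicity reduces to the shift by 1.\<close>
  have "(\<Sum>j<d. h k (int j - 1)) = (\<Sum>j<d. h k (- (int j - 1)))"
    by (simp only: h_even)
  also have "\<dots> = (\<Sum>j<d. h k (int (d - Suc j) + 2))"
  proof (rule sum.cong)
    fix j assume "j \<in> {..<d}"
    then have "int (d - Suc j) + 2 = - (int j - 1) + int d" by simp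
    then show "h k (- (int j - 1)) = h k (int (d - Suc j) + 2)"
      using h_periodic by metis
  qed simp
  also have "\<dots> = (\<Sum>j<d. h k (int j + 2))"
    by (rule sum.nat_diff_reindex)
  also have "\<dots> = (\<Sum>j<d. h k (int j + 1))"
  proof -
    have "(\<Sum>j<Suc d. h k (int j + 1)) = h k 1 + (\<Sum>j<d. h k (int j + 2))"
      by (subst sum.lessThan_Suc_shift) (simp add: algebra_simps)
    then show ?thesis
      using h_periodic[of k 1] by (simp add: add.commute)
  qed
  finally have "(\<Sum>j<d. h k (int j - 1)) = 1"
    using sum_h_shift[of k] Suc by simp
  then show ?case
    using sum_h_shift[of k] Suc by (simp add: h_Suc sum.distrib flip: sum_distrib_left)
qed

lemma sep_eq_Max: "sep {..<d} (dist_at k) (\<lambda>_. 1 / real d) = Max ((\<lambda>j. 1 - real d * h k (int j)) ` {..<d})"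
proof -
  \<comment> \<open>Rotation by \<open>x0 + N\<close> maps the residues onto themselves, so the
    maximum may run over centred coordinates.\<close>
  have "{..<d} = (\<lambda>j. nat ((int x0 + int N + int j) mod int d)) ` {..<d}" (is "_ = ?f ` _")
  proof (intro set_eqI iffI)
    fix e assume e: "e \<in> {..<d}"
    define j where "j = nat ((int e - int x0 - int N) mod int d)"
    have "j < d" "int j = (int e - int x0 - int N) mod int d"
      using d_pos by (simp_all add: j_def nat_less_iff)
    moreover from this have "(int x0 + int N + int j) mod int d = int e mod int d"
      by (simp add: mod_add_right_eq)
    ultimately have "e = ?f j" "j \<in> {..<d}"
      using e by simp_all
    then show "e \<in> ?f ` {..<d}" by blast
  qed (use d_pos in \<open>auto simp: nat_less_iff\<close>)
  then have "(\<lambda>e. 1 - dist_at k e / (1 / real d)) ` {..<d} =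
      (\<lambda>e. 1 - dist_at k e / (1 / real d)) ` ?f ` {..<d}"
    by simp
  then show ?thesis
    by (simp only: sep_def image_image h_def) (simp add: mult.commute)
qed

end

section \<open>Unimodality and the separation distance\<close>

text \<open>
  The conditions on \<open>p\<close> say precisely that one step preserves unimodality of the
  symmetric distributions on the circle.
\<close>

locale unimodal_circle_walk = even_circle_walk +
  assumes p_unimodal: "N > 1 \<and> p \<le> 1/3 \<or> N = 1 \<and> p \<le> 1/4"
begin

text \<open>The increments \<open>D\<close> obey the same recursion and are odd under reflection at
  both ends of the half circle. For \<open>N > 1\<close> at most one neighbour is reflected, leaving
  the weight \<open>1 - 3 * p\<close>; for \<open>N = 1\<close> both are, leaving
  \<open>1 - 4 * p\<close>.\<close>

lemma h_mono_step: "j < N \<Longrightarrow> h k (int j) \<le> h k (int j + 1)"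
proof (induction k arbitrary: j)
  case 0
  have "\<not> int d dvd int N + int j"
    using N 0 d by (auto dest!: zdvd_imp_le)
  then show ?case
    by (simp add: h_0)
next
  case (Suc k)
  define D where "D = (\<lambda>z. h k (z + 1) - h k z)"
  have D: "h (Suc k) (z + 1) - h (Suc k) z = (1 - 2 * p) * D z + p * D (z - 1) + p * D (z + 1)" for z
    by (simp add: h_Suc D_def algebra_simps)
  have nonneg: "D (int i) \<ge> 0" if "i < N" for i
    using Suc.IH[OF that] by (simp add: D_def)
  have refl0: "D (-1) = - D 0"
    using h_even[of k 1] by (simp add: D_def)
  have reflN: "D (int N) = - D (int N - 1)"
  proof -
    have "int N + 1 = - (int N - 1) + int d" by (simp add: d)
    then have "h k (int N + 1) = h k (int N - 1)"
      by (simp only: h_periodic h_even)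
    then show ?thesis
      by (simp add: D_def)
  qed
  have "(1 - 2 * p) * D (int j) + p * D (int j - 1) + p * D (int j + 1) \<ge> 0"
  proof (cases "N = 1")
    case True
    with Suc.prems p_unimodal have "j = 0" "p \<le> 1/4" by auto
    then have "(1 - 2 * p) * D (int j) + p * D (int j - 1) + p * D (int j + 1) = (1 - 4 * p) * D 0"
      using refl0 reflN True by (simp add: algebra_simps)
    then show ?thesis
      using nonneg[of 0] N \<open>p \<le> 1/4\<close> by simp
  next
    case False
    with p_unimodal have p3: "p \<le> 1/3" and N1: "N > 1" by auto
    have left: "p * D (int j - 1) \<ge> 0" if "j \<noteq> 0"
      using nonneg[of "j - 1"] that Suc.prems p by (simp add: of_nat_diff)
    have right: "p * D (int j + 1) \<ge> 0" if "Suc j < N"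
      using nonneg[of "Suc j"] that p by (simp add: add.commute)
    \<comment> \<open>Splits \<open>1 - 2 * p\<close> as \<open>(1 - 3 * p) + p\<close>: at an end
      the summand \<open>p\<close> cancels the reflected neighbour.\<close>
    have scale: "(1 - 3 * p) * D (int j) \<ge> 0" "p * D (int j) \<ge> 0"
      using nonneg[of j] Suc.prems p3 p by simp_all
    consider "j = 0" | "j = N - 1" | "j \<noteq> 0" "Suc j < N"
      using Suc.prems by linarith
    then show ?thesis
    proof cases
      case 1
      then show ?thesis
        using scale right refl0 N1 by (simp add: algebra_simps)
    next
      case 2
      then have "int j = int N - 1" using N by simp
      then have "p * D (int j + 1) = - p * D (int j)"
        using reflN by simp
      then show ?thesis
        using scale left 2 N1 by (simp add: algebra_simps)
    next
      case 3
      then show ?thesis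
        using scale left right by (simp add: algebra_simps)
    qed
  qed
  then show ?case
    using D[of "int j"] by simp
qed

lemma h_min:
  assumes "j < d"
  shows "h k 0 \<le> h k (int j)"
proof -
  have half: "h k 0 \<le> h k (int i)" if "i \<le> N" for i
    using that
  proof (induction i)
    case (Suc i)
    then show ?case
      using h_mono_step[of i k] by (simp add: add.commute)
  qed simp
  show ?thesis
  proof (cases "j \<le> N")
    case False
    have "h k (int (d - j)) = h k (- int j + int d)"
      using assms by (simp add: of_nat_diff)
    also have "\<dots> = h k (int j)"
      by (simp only: h_periodic h_even)
    finally show ?thesis
      using half[of "d - j"] False d by simp
  qed (use half in simp)
qed

lemma sep_eq: "sep {..<d} (dist_at k) (\<lambda>_. 1 / real d) = 1 - real d * h k 0"
proof -
  have "Max ((\<lambda>j. 1 - real d * h k (int j)) ` {..<d}) = 1 - real d * h k 0"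
  proof (rule Max_eqI)
    show "1 - real d * h k 0 \<in> (\<lambda>j. 1 - real d * h k (int j)) ` {..<d}"
      using d_pos by (intro image_eqI[of _ _ 0]) auto
  qed (auto intro!: mult_left_mono h_min)
  then show ?thesis
    by (simp add: sep_eq_Max)
qed

section \<open>The potential and the sum of the separations\<close>

text \<open>\<open>j * (d - j) / (2 * p)\<close> is the expected hitting time of the antipode from \<open>j\<close>.\<close>

definition potential :: "nat \<Rightarrow> real" where
  "potential k = (\<Sum>j<d. real j * (real d - real j) * h k (int j)) / (2 * p)"

text \<open>Off the antipode one step lowers the hitting time by 1 on average; from the antipode it
  raises it by \<open>d - 1\<close>. Averaging over the law gives the drop.\<close>

lemma potential_Suc: "potential k - potential (Suc k) = 1 - real d * h k 0"
proof -
  let ?w = "\<lambda>j. real j * (real d - real j)"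
  have "(\<Sum>j<d. ?w j * h (Suc k) (int j)) - (\<Sum>j<d. ?w j * h k (int j)) =
      p * (\<Sum>j<d. ?w j * (h k (int j - 1) - 2 * h k (int j) + h k (int j + 1)))"
    by (simp add: h_Suc sum_distrib_left algebra_simps flip: sum_subtractf)
  \<comment> \<open>With \<open>c = n = d\<close> one boundary term vanishes and periodicity merges
    the other two into \<open>2 * real d * h k 0\<close>.\<close>
  also have "\<dots> = p * (2 * real d * h k 0 - 2)"
    using h_periodic[of k 0] by (subst summation_by_parts_quadratic) (simp add: sum_h algebra_simps)
  finally show ?thesis
    using p by (simp add: potential_def field_simps)
qed

lemma potential_0: "potential 0 = real N ^ 2 / (2 * p)"
proof -
  have "(\<Sum>j<d. real j * (real d - real j) * h 0 (int j)) =
      (\<Sum>j<d. if j = N then real j * (real d - real j) else 0)"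
    by (intro sum.cong) (auto simp: h_init)
  also have "\<dots> = real N ^ 2"
    using N by (simp add: d power2_eq_square)
  finally show ?thesis
    by (simp add: potential_def)
qed

text \<open>A single nonnegative excess is at most their sum. Hence vanishing separation forces the
  law to the uniform one.\<close>

lemma excess_le:
  assumes "j < d"
  shows "h k (int j) - h k 0 \<le> 1 - real d * h k 0"
proof -
  have "h k (int j) - h k 0 \<le> (\<Sum>i<d. h k (int i) - h k 0)"
    using assms h_min by (intro member_le_sum) auto
  then show ?thesis
    by (simp add: sum_subtractf sum_h)
qed

text \<open>The telescoped sum also yields convergence: its bound by \<open>potential 0\<close>
  makes the separation tend to 0, hence the law tend to uniform, which fixes the limit of the
  potential.\<close>

lemma sep_sums:
  "(\<lambda>k. sep {..<d} (dist_at k) (\<lambda>_. 1 / real d)) sums ((2 * real N ^ 2 + 1) / (12 * p))"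
proof -
  define a where "a = (\<lambda>k. 1 - real d * h k 0)"
  have a_nonneg: "a k \<ge> 0" for k
    using excess_le[of 0 k] d_pos by (simp add: a_def)
  have partial: "(\<Sum>k<n. a k) = potential 0 - potential n" for n
    by (simp add: a_def flip: potential_Suc) (simp add: sum_lessThan_telescope')
  have "potential n \<ge> 0" for n
    using p unfolding potential_def
    by (intro divide_nonneg_nonneg sum_nonneg mult_nonneg_nonneg h_nonneg) auto
  then have "summable a"
    using a_nonneg by (intro summableI_nonneg_bounded[of _ "potential 0"]) (auto simp: partial)
  then have a_lim: "a \<longlonglongrightarrow> 0"
    by (rule summable_LIMSEQ_zero)
  have h0_lim: "(\<lambda>k. h k 0) \<longlonglongrightarrow> 1 / real d"
  proof -
    have "(\<lambda>k. (1 - a k) / real d) \<longlonglongrightarrow> (1 - 0) / real d"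
      by (intro tendsto_intros a_lim) (use d_pos in simp)
    then show ?thesis
      using d_pos by (simp add: a_def)
  qed
  have h_lim: "(\<lambda>k. h k (int j)) \<longlonglongrightarrow> 1 / real d" if "j < d" for j
  proof -
    have "(\<lambda>k. h k (int j) - h k 0) \<longlonglongrightarrow> 0"
      using that h_min excess_le
      by (intro tendsto_sandwich[OF _ _ tendsto_const a_lim] always_eventually) (auto simp: a_def)
    from tendsto_add[OF this h0_lim] show ?thesis by simp
  qed
  have "potential \<longlonglongrightarrow> (\<Sum>j<d. real j * (real d - real j) * (1 / real d)) / (2 * p)"
    unfolding potential_def by (intro tendsto_intros h_lim) (use p in auto)
  also have "(\<Sum>j<d. real j * (real d - real j) * (1 / real d)) / (2 * p) =
      (real d ^ 2 - 1) / (12 * p)"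
    using d_pos p unfolding sum_distrib_right[symmetric] sum_parabola
    by (simp add: field_simps power2_eq_square)
  finally have "(\<lambda>n. potential 0 - potential n) \<longlonglongrightarrow> potential 0 - (real d ^ 2 - 1) / (12 * p)"
    by (intro tendsto_intros)
  also have "potential 0 - (real d ^ 2 - 1) / (12 * p) = (2 * real N ^ 2 + 1) / (12 * p)"
    unfolding potential_0 using p by (simp add: d field_simps)
  finally show ?thesis
    by (simp add: sums_def partial sep_eq flip: a_def)
qed

end

text \<open>The second eigenvalue is \<open>1 - 4 * p\<close>, and the deviations at the two states
  are opposite; for p > 1/4 their signs alternate, whence the absolute value.\<close>

lemma (in even_circle_walk) sep_two_state:
  assumes "N = 1"
  shows "sep {..<d} (dist_at k) (\<lambda>_. 1 / real d) = \<bar>1 - 4 * p\<bar> ^ k"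
proof -
  have d2: "d = 2" using assms d by simp
  have s: "h k 0 + h k 1 = 1" for k
    using sum_h[of k] by (simp add: d2 numeral_2_eq_2)
  have h0: "1 - 2 * h k 0 = (1 - 4 * p) ^ k"
  proof (induction k)
    case 0
    then show ?case using h_init[of 0] N d_pos by simp
  next
    case (Suc k)
    have "h (Suc k) 0 = (1 - 2 * p) * h k 0 + 2 * p * (1 - h k 0)"
      using h_even[of k 1] s[of k] by (simp add: h_Suc)
    then have "1 - 2 * h (Suc k) 0 = (1 - 4 * p) * (1 - 2 * h k 0)"
      by (simp add: algebra_simps)
    then show ?case by (simp add: Suc)
  qed
  have "{..<d} = {0, 1}" using d2 by auto
  moreover have "1 - 2 * h k 1 = - ((1 - 4 * p) ^ k)"
    using h0 s[of k] by simp
  ultimately have "Max ((\<lambda>j. 1 - real d * h k (int j)) ` {..<d}) =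
      max ((1 - 4 * p) ^ k) (- ((1 - 4 * p) ^ k))"
    using h0 by (simp add: d2)
  then show ?thesis
    unfolding sep_eq_Max power_abs[symmetric] by (simp add: max_def)
qed

section \<open>From separation to expectation\<close>

lemma randomized_stopping_time_measurable:
  assumes "randomized_stopping_time M E X T"
  shows "T \<in> M \<rightarrow>\<^sub>M count_space UNIV"
proof -
  obtain F :: "enat \<Rightarrow> 'a measure" where F: "filtration (space M) F" "\<And>t. sets (F t) \<subseteq> sets M"
    and T: "stopping_time F T"
    using assms unfolding randomized_stopping_time_def by blast
  have le: "{\<omega> \<in> space M. T \<omega> \<le> t} \<in> sets M" for t
  proof -
    have "Measurable.pred (F t) (\<lambda>\<omega>. T \<omega> \<le> t)"
      using T by (rule stopping_timeD)
    then have "{\<omega> \<in> space (F t). T \<omega> \<le> t} \<in> sets (F t)"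
      by (simp add: pred_def)
    then show ?thesis
      using F filtration.space_F[OF F(1)] by auto
  qed
  have "{\<omega> \<in> space M. T \<omega> = t} \<in> sets M" for t
  proof -
    \<comment> \<open>Every value below \<open>t\<close> is finite, also when \<open>t\<close> is
      infinite, so removing the events for natural \<open>m\<close> suffices.\<close>
    have "{\<omega> \<in> space M. T \<omega> = t} =
        {\<omega> \<in> space M. T \<omega> \<le> t} - (\<Union>m\<in>{m. enat m < t}. {\<omega> \<in> space M. T \<omega> \<le> enat m})"
    proof (intro set_eqI iffI)
      fix \<omega>
      assume \<omega>: "\<omega> \<in> {\<omega> \<in> space M. T \<omega> \<le> t} - (\<Union>m\<in>{m. enat m < t}. {\<omega> \<in> space M. T \<omega> \<le> enat m})"
      have "\<not> T \<omega> < t"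
      proof
        assume "T \<omega> < t"
        then obtain i where "T \<omega> = enat i" by (cases "T \<omega>") auto
        with \<omega> \<open>T \<omega> < t\<close> show False by auto
      qed
      then show "\<omega> \<in> {\<omega> \<in> space M. T \<omega> = t}" using \<omega> by auto
    qed auto
    then show ?thesis
      using le by auto
  qed
  then show ?thesis
    by (subst measurable_count_space_eq_countable) (auto simp: vimage_def Int_def conj_commute)
qed

text \<open>Tail-sum formula: the mean is the series of P(T > k), and for a fastest time these tails
  are the separations.\<close>

lemma fastest_strong_stationary_time_expectation:
  assumes "prob_space M"
    and T: "fastest_strong_stationary_time M E \<nu> P \<pi> X T"
    and "(\<lambda>k. sep E (chain_dist E \<nu> P k) \<pi>) sums s"
  shows "(\<integral>\<^sup>+\<omega>. ennreal_of_enat (T \<omega>) \<partial>M) = ennreal s"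
proof -
  interpret prob_space M by fact
  have meas: "T \<in> M \<rightarrow>\<^sub>M count_space UNIV"
    using T unfolding fastest_strong_stationary_time_def strong_stationary_time_def
    by (blast intro: randomized_stopping_time_measurable)
  have tail: "sep E (chain_dist E \<nu> P k) \<pi> = prob {\<omega> \<in> space M. enat k < T \<omega>}" for k
    using T unfolding fastest_strong_stationary_time_def by blast
  have "(\<integral>\<^sup>+\<omega>. ennreal_of_enat (T \<omega>) \<partial>M) = (\<Sum>k. emeasure M {\<omega> \<in> space M. enat k < T \<omega>})"
    by (rule nn_integral_enat_function[OF meas])
  also have "\<dots> = (\<Sum>k. ennreal (sep E (chain_dist E \<nu> P k) \<pi>))"
    by (simp add: tail emeasure_eq_measure)
  also have "\<dots> = ennreal s"
    using assms(3) by (intro suminf_ennreal_eq) (auto simp: tail)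
  finally show ?thesis .
qed

theorem lemma4p1:
  fixes N d x0 :: nat and p :: real
    and M :: "'w measure" and X :: "nat \<Rightarrow> 'w \<Rightarrow> nat" and T :: "'w \<Rightarrow> enat"
  assumes "N \<ge> 1" and "d = 2 * N" and "x0 < d"
    and "markov_chain M {..<d} (\<lambda>i. of_bool (i = x0)) (circle_walk d p) X"
    and "fastest_strong_stationary_time M {..<d} (\<lambda>i. of_bool (i = x0)) (circle_walk d p)
           (\<lambda>_. 1 / real d) X T"
  shows "(N > 1 \<and> p \<in> {0<..1/3} \<longrightarrow>
            (\<integral>\<^sup>+\<omega>. ennreal_of_enat (T \<omega>) \<partial>M) = ennreal ((2 * real N ^ 2 + 1) / (12 * p))) \<and>
         (N = 1 \<and> p \<in> {0<..1/4} \<longrightarrow>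
            (\<integral>\<^sup>+\<omega>. ennreal_of_enat (T \<omega>) \<partial>M) = ennreal (1 / (4 * p))) \<and>
         (N = 1 \<and> p \<in> {1/4<..<1/2} \<longrightarrow>
            (\<integral>\<^sup>+\<omega>. ennreal_of_enat (T \<omega>) \<partial>M) = ennreal (1 / (2 * (1 - 2 * p))))"
proof -
  have "prob_space M"
    using assms(4) by (simp add: markov_chain_def)
  note expectation = fastest_strong_stationary_time_expectation[OF this assms(5)]
  have unimodal: "(\<integral>\<^sup>+\<omega>. ennreal_of_enat (T \<omega>) \<partial>M) = ennreal ((2 * real N ^ 2 + 1) / (12 * p))"
    if "0 < p" "N > 1 \<and> p \<le> 1/3 \<or> N = 1 \<and> p \<le> 1/4"
  proof -
    interpret unimodal_circle_walk N d x0 p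
      by unfold_locales (use assms that in auto)
    show ?thesis
      by (rule expectation[OF sep_sums])
  qed
  have two_state: "(\<integral>\<^sup>+\<omega>. ennreal_of_enat (T \<omega>) \<partial>M) = ennreal (1 / (2 * (1 - 2 * p)))"
    if "N = 1" "1/4 < p" "p < 1/2"
  proof -
    interpret even_circle_walk N d x0 p
      by unfold_locales (use assms that in auto)
    \<comment> \<open>The ratio is \<open>4 * p - 1\<close>, below 1 since p < 1/2.\<close>
    have "(\<lambda>k. \<bar>1 - 4 * p\<bar> ^ k) sums (1 / (1 - \<bar>1 - 4 * p\<bar>))"
      by (rule geometric_sums) (use that in auto)
    moreover have "1 - \<bar>1 - 4 * p\<bar> = 2 * (1 - 2 * p)"
      using that by simp
    ultimately show ?thesis
      using that by (intro expectation) (simp add: sep_two_state)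
  qed
  show ?thesis
    \<comment> \<open>For \<open>N = 1\<close> the general formula reads 3/(12p) = 1/(4p).\<close>
    using unimodal two_state by auto
qed

end
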